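(* Let $n,m\ge1$ be integers, let $\rho$ be a $2^n\times2^n$ density matrix with eigenvalues $\lambda_1(\rho)\ge\lambda_2(\rho)\ge\dots\ge\lambda_{2^n}(\rho)$ (with the convention $\lambda_{2^n+1}(\rho)=0$), let $\hat\rho$ be the linear estimator of $\rho$ built from $m$ independent repetitions of each of the $3^n$ Pauli measurements, let $\nu>0$, and let $\hat k$ be the rank selected by the rank-penalized procedure with parameter $\nu$, i.e. $$\hat k=\max\{k:\lambda_k(\hat\rho)\ge\sqrt\nu\}.$$ If there exist $k\in\{1,\dots,2^n\}$ and $\delta\in(0,1]$ such that $\lambda_k(\rho)>(1+\delta)\sqrt\nu$ and $\lambda_{k+1}(\rho)<(1-\delta)\sqrt\nu$, then $$\mathbb P(\hat k=k)\ge1-\mathbb P\left(\|\hat\rho-\rho\|\ge\delta\sqrt\nu\right).$$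
   Context: A $2^n\times 2^n$ density matrix is a complex Hermitian positive semidefinite matrix $\rho$ with $\mathrm{Tr}(\rho)=1$. Let $\sigma_x,\sigma_y,\sigma_z$ be the $2\times2$ Pauli matrices and $\sigma_I=I$ the $2\times 2$ identity. Put $\mathcal E^n=\{x,y,z\}^n$, $\mathcal R^n=\{-1,1\}^n$, $\mathcal M^n=\{I,x,y,z\}^n$. For $\mathbf b\in\mathcal M^n$ set $\sigma_{\mathbf b}=\sigma_{b_1}\otimes\cdots\otimes\sigma_{b_n}$, $E_{\mathbf b}=\{j: b_j=I\}$, and let $d(\mathbf b)$ be the cardinality of $E_{\mathbf b}$. For $a\in\{x,y,z\}$, $r\in\{-1,1\}$, $P^a_r$ is the orthogonal projector onto the eigenspace of $\sigma_a$ for the eigenvalue $r$; $P^{\mathbf a}_{\mathbf r}=P^{a_1}_{r_1}\otimes\cdots\otimes P^{a_n}_{r_n}$. Data: $R^{\mathbf a,i}$, $\mathbf a\in\mathcal E^n$, $1\le i\le m$, are independent random variables with values in $\mathcal R^n$ such that $\mathbb P(R^{\mathbf a,i}=\mathbf r)=\mathrm{Tr}(\rho\cdot P^{\mathbf a}_{\mathbf r})$ for all $\mathbf r\in\mathcal R^n$. Put $\hat p_{(\mathbf r,\mathbf a)}=\frac1m\sum_{i=1}^m\delta_{R^{\mathbf a,i},\mathbf r}$ ($\delta$ the Kronecker symbol). Let $P_{(\mathbf r,\mathbf a),\mathbf b}=\prod_{j\notin E_{\mathbf b}}r_j\,\mathbf I(a_j=b_j)$ ($\mathbf I$ the indicator,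 empty products equal $1$). The linear estimator is $$\hat\rho_{\mathbf b}=\frac1{3^{d(\mathbf b)}2^n}\sum_{(\mathbf r,\mathbf a)\in\mathcal R^n\times\mathcal E^n}\hat p_{(\mathbf r,\mathbf a)}P_{(\mathbf r,\mathbf a),\mathbf b},\qquad \hat\rho=\sum_{\mathbf b\in\mathcal M^n}\hat\rho_{\mathbf b}\sigma_{\mathbf b}.$$ $\lambda_1(\hat\rho)\ge\lambda_2(\hat\rho)\ge\dots\ge\lambda_{2^n}(\hat\rho)$ denote the ordered eigenvalues of $\sqrt{\hat\rho^{\star}\hat\rho}$ (the singular values of $\hat\rho$); in the definition of $\hat k$, $k$ ranges over $\{1,\dots,2^n\}$, and $\hat k=0$ if the set is empty. (This $\hat k$ is the rank of the rank-penalized estimator, a minimizer over Hermitian $R$ of $\|R-\hat\rho\|_F^2+\nu\cdot\mathrm{rank}(R)$, where $\|A\|_F^2=\mathrm{Tr}(A^\dagger A)$.) $\|A\|=\sup_{|v|_2=1}|Av|_2$ (over complex vectors $v$, with $|\cdot|_2$ the Euclidean norm) is the operator norm. *)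

theory Defs
  imports
    "HOL-Probability.Probability"
    "HOL-Computational_Algebra.Fundamental_Theorem_Algebra"
    "Jordan_Normal_Form.Schur_Decomposition"
begin

section \<open>Complex matrices\<close>

definition mtrace :: "complex mat \<Rightarrow> complex" where
  "mtrace A = (\<Sum>i<dim_row A. A $$ (i, i))"

definition hermitian_mat :: "complex mat \<Rightarrow> bool" where
  "hermitian_mat A \<longleftrightarrow> square_mat A \<and> mat_adjoint A = A"

text \<open>For Hermitian \<open>A\<close> the number \<open>(A *\<^sub>v v) \<bullet>c v\<close> is real, so taking the real part
  loses nothing.\<close>

definition psd_mat :: "complex mat \<Rightarrow> bool" where
  "psd_mat A \<longleftrightarrow> hermitian_mat A \<and> (\<forall>v\<in>carrier_vec (dim_row A). 0 \<le> Re ((A *\<^sub>v v) \<bullet>c v))"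

definition density_matrix :: "nat \<Rightarrow> complex mat \<Rightarrow> bool" where
  "density_matrix n \<rho> \<longleftrightarrow> \<rho> \<in> carrier_mat (2 ^ n) (2 ^ n) \<and> psd_mat \<rho> \<and> mtrace \<rho> = 1"

text \<open>The eigenvalues of a Hermitian matrix in decreasing order, repeated according to
  multiplicity; they are real, so \<open>Re\<close> is only a type conversion.  The index \<open>k\<close> starts
  at 1, and the value is 0 beyond the dimension.\<close>

definition ordered_eigvals :: "complex mat \<Rightarrow> real list" where
  "ordered_eigvals A = rev (sorted_list_of_multiset (image_mset Re (proots (char_poly A))))"

definition nth_eigval :: "complex mat \<Rightarrow> nat \<Rightarrow> real" where
  "nth_eigval A k = (if 1 \<le> k \<and> k \<le> dim_row A then ordered_eigvals A ! (k - 1) else 0)"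

definition psd_sqrt :: "complex mat \<Rightarrow> complex mat" where
  "psd_sqrt A = (THE B. B \<in> carrier_mat (dim_row A) (dim_row A) \<and> psd_mat B \<and> B * B = A)"

definition nth_singval :: "complex mat \<Rightarrow> nat \<Rightarrow> real" where
  "nth_singval A k = nth_eigval (psd_sqrt (mat_adjoint A * A)) k"

definition eucl_norm :: "complex vec \<Rightarrow> real" where
  "eucl_norm v = sqrt (\<Sum>i<dim_vec v. (cmod (vec_index v i))\<^sup>2)"

definition op_norm :: "complex mat \<Rightarrow> real" where
  "op_norm A = (SUP v\<in>{v \<in> carrier_vec (dim_col A). eucl_norm v = 1}. eucl_norm (A *\<^sub>v v))"

definition kron :: "complex mat \<Rightarrow> complex mat \<Rightarrow> complex mat" where
  "kron A B = Matrix.mat (dim_row A * dim_row B) (dim_col A * dim_col B)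
     (\<lambda>(i, j). A $$ (i div dim_row B, j div dim_col B) * B $$ (i mod dim_row B, j mod dim_col B))"

definition kron_list :: "complex mat list \<Rightarrow> complex mat" where
  "kron_list As = foldr kron As (1\<^sub>m 1)"

definition eigenspace :: "complex mat \<Rightarrow> complex \<Rightarrow> complex vec set" where
  "eigenspace A c = {v \<in> carrier_vec (dim_row A). A *\<^sub>v v = c \<cdot>\<^sub>v v}"

definition orth_projector :: "nat \<Rightarrow> complex vec set \<Rightarrow> complex mat" where
  "orth_projector d V = (THE P. P \<in> carrier_mat d d \<and> hermitian_mat P \<and> P * P = P
     \<and> (\<lambda>v. P *\<^sub>v v) ` carrier_vec d = V)"

section \<open>Pauli measurements\<close>

datatype pauli = PauliI | PauliX | PauliY | PauliZ

fun sigma1 :: "pauli \<Rightarrow> complex mat" where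
  "sigma1 PauliI = 1\<^sub>m 2"
| "sigma1 PauliX = mat_of_rows_list 2 [[0, 1], [1, 0]]"
| "sigma1 PauliY = mat_of_rows_list 2 [[0, - \<i>], [\<i>, 0]]"
| "sigma1 PauliZ = mat_of_rows_list 2 [[1, 0], [0, - 1]]"

text \<open>Words of length \<open>n\<close> are lists, with positions \<open>0, \<dots>, n - 1\<close>.\<close>

definition settings :: "nat \<Rightarrow> pauli list set" where
  "settings n = {a. length a = n \<and> set a \<subseteq> {PauliX, PauliY, PauliZ}}"

definition outcomes :: "nat \<Rightarrow> int list set" where
  "outcomes n = {r. length r = n \<and> set r \<subseteq> {- 1, 1}}"

definition pauli_words :: "nat \<Rightarrow> pauli list set" where
  "pauli_words n = {b. length b = n}"

definition sigma :: "pauli list \<Rightarrow> complex mat" where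
  "sigma b = kron_list (map sigma1 b)"

definition id_positions :: "pauli list \<Rightarrow> nat set" where
  "id_positions b = {j. j < length b \<and> b ! j = PauliI}"

definition proj1 :: "pauli \<Rightarrow> int \<Rightarrow> complex mat" where
  "proj1 a r = orth_projector 2 (eigenspace (sigma1 a) (of_int r))"

definition proj :: "pauli list \<Rightarrow> int list \<Rightarrow> complex mat" where
  "proj a r = kron_list (map2 proj1 a r)"

section \<open>The linear estimator and the selected rank\<close>

text \<open>In the following, \<open>R a i \<omega>\<close> is the outcome of the \<open>i\<close>-th repetition
  (\<open>1 \<le> i \<le> m\<close>) of the measurement with setting \<open>a\<close>.\<close>

definition p_hat :: "nat \<Rightarrow> (pauli list \<Rightarrow> nat \<Rightarrow> 'w \<Rightarrow> int list) \<Rightarrow> int list \<Rightarrow> pauli list \<Rightarrow> 'w \<Rightarrow> real"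
  where "p_hat m R r a \<omega> = 1 / real m * (\<Sum>i=1..m. if R a i \<omega> = r then 1 else 0)"

definition P_coeff :: "int list \<Rightarrow> pauli list \<Rightarrow> pauli list \<Rightarrow> real" where
  "P_coeff r a b = (\<Prod>j\<in>{..<length b} - id_positions b.
     of_int (r ! j) * (if a ! j = b ! j then 1 else 0))"

definition rho_hat_coeff ::
  "nat \<Rightarrow> nat \<Rightarrow> (pauli list \<Rightarrow> nat \<Rightarrow> 'w \<Rightarrow> int list) \<Rightarrow> pauli list \<Rightarrow> 'w \<Rightarrow> real" where
  "rho_hat_coeff n m R b \<omega> = 1 / (3 ^ card (id_positions b) * 2 ^ n) *
     (\<Sum>(r, a)\<in>outcomes n \<times> settings n. p_hat m R r a \<omega> * P_coeff r a b)"

definition rho_hat ::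
  "nat \<Rightarrow> nat \<Rightarrow> (pauli list \<Rightarrow> nat \<Rightarrow> 'w \<Rightarrow> int list) \<Rightarrow> 'w \<Rightarrow> complex mat" where
  "rho_hat n m R \<omega> = Matrix.mat (2 ^ n) (2 ^ n) (\<lambda>(i, j).
     \<Sum>b\<in>pauli_words n. complex_of_real (rho_hat_coeff n m R b \<omega>) * sigma b $$ (i, j))"

definition selected_rank :: "real \<Rightarrow> complex mat \<Rightarrow> nat" where
  "selected_rank \<nu> A = (let K = {k \<in> {1..dim_row A}. nth_singval A k \<ge> sqrt \<nu>}
     in if K = {} then 0 else Max K)"

end

theory Submission
  imports Defs
begin

text \<open>
  The claim is an inclusion of events.  Let \<open>P = \<rho>\<close> and let \<open>A\<close> be a value of the
  estimator with \<open>\<parallel>A - P\<parallel> < \<delta> \<surd>\<nu>\<close>.  Singular values move by at most the operator norm of a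
  perturbation (Weyl), and the singular values of the positive semidefinite \<open>P\<close> are its eigenvalues.
  Hence \<open>\<sigma>\<^sub>k(A) > (1 + \<delta>) \<surd>\<nu> - \<delta> \<surd>\<nu> = \<surd>\<nu>\<close> and \<open>\<sigma>\<^sub>k\<^sub>+\<^sub>1(A) < (1 - \<delta>) \<surd>\<nu> + \<delta> \<surd>\<nu> = \<surd>\<nu>\<close>;
  as singular values decrease, the threshold \<open>\<surd>\<nu>\<close> selects exactly \<open>k\<close> of them.  So the event
  \<open>\<parallel>A - P\<parallel> < \<delta> \<surd>\<nu>\<close> lies inside the event that the selected rank is \<open>k\<close>
  (\<open>selected_rank_of_close_matrix\<close>), and its probability is one minus that of its complement.

  Weyl's inequality appears here as \<open>nth_eigval_perturbation\<close>, which compares two positive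
  semidefinite matrices only through the norms \<open>|Av|\<close> and \<open>|Bv|\<close>.  In this form it applies to
  \<open>\<surd>(A\<^sup>*A)\<close> at once, because \<open>|\<surd>(A\<^sup>*A) v| = |Av|\<close>.  Its proof is the dimension count behind the
  Courant-Fischer principle: the span of the first \<open>k\<close> eigenvectors of one matrix meets the span of
  all but the first \<open>k - 1\<close> eigenvectors of the other (\<open>exists_common_vector\<close>).  The eigenvectors come
  from the spectral theorem (\<open>hermitian_diagonalization\<close>), and the operator \<open>\<surd>(A\<^sup>*A)\<close> makes sense
  because positive semidefinite square roots exist and are unique (\<open>psd_sqrt_exists\<close>,
  \<open>psd_sqrt_unique\<close>).

  Complements and monotonicity of probability need measurable events.  They are, since the estimator
  is a function of finitely many random variables with discrete values (\<open>sets_rho_hat\<close>).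
\<close>

section \<open>Adjoints, the Euclidean norm and unitary matrices\<close>

lemma dim_mat_adjoint [simp]:
  "dim_row (mat_adjoint A) = dim_col A" "dim_col (mat_adjoint A) = dim_row A"
  by (simp_all add: mat_adjoint_def)

lemma mat_adjoint_carrier [simp]:
  "A \<in> carrier_mat n m \<Longrightarrow> mat_adjoint A \<in> carrier_mat m n"
  by (rule carrier_matI) simp_all

lemma mat_adjoint_index [simp]:
  fixes A :: "complex mat"
  assumes "i < dim_col A" "j < dim_row A"
  shows "mat_adjoint A $$ (i, j) = cnj (A $$ (j, i))"
  using assms by (simp add: mat_adjoint_def mat_of_rows_index)

lemma mat_adjoint_adjoint [simp]: "mat_adjoint (mat_adjoint A) = (A :: complex mat)"
  by (rule eq_matI) auto

lemma mat_adjoint_one [simp]: "mat_adjoint (1\<^sub>m n) = (1\<^sub>m n :: complex mat)"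
  by (rule eq_matI) auto

lemma mat_adjoint_mult:
  fixes A B :: "complex mat"
  assumes "A \<in> carrier_mat n m" "B \<in> carrier_mat m l"
  shows "mat_adjoint (A * B) = mat_adjoint B * mat_adjoint A"
  using assms by (intro eq_matI) (auto simp: scalar_prod_def mult.commute)

lemma cinner_adjoint:
  fixes A :: "complex mat"
  assumes A: "A \<in> carrier_mat n m" and v: "v \<in> carrier_vec m" and w: "w \<in> carrier_vec n"
  shows "(A *\<^sub>v v) \<bullet>c w = v \<bullet>c (mat_adjoint A *\<^sub>v w)"
proof -
  have "(A *\<^sub>v v) \<bullet>c w = (\<Sum>i<n. \<Sum>j<m. A $$ (i, j) * vec_index v j * cnj (vec_index w i))"
    using assms by (auto simp: scalar_prod_def sum_distrib_right atLeast0LessThan intro!: sum.cong)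
  also have "\<dots> = (\<Sum>j<m. \<Sum>i<n. A $$ (i, j) * vec_index v j * cnj (vec_index w i))"
    by (rule sum.swap)
  also have "\<dots> = v \<bullet>c (mat_adjoint A *\<^sub>v w)"
    using assms by (auto simp: scalar_prod_def sum_distrib_left atLeast0LessThan intro!: sum.cong)
  finally show ?thesis .
qed

lemma eucl_norm_nonneg [simp]: "0 \<le> eucl_norm v"
  by (simp add: eucl_norm_def sum_nonneg)

lemma eucl_norm_sq: "(eucl_norm v)\<^sup>2 = (\<Sum>i<dim_vec v. (cmod (vec_index v i))\<^sup>2)"
  by (simp add: eucl_norm_def sum_nonneg)

lemma cinner_self: "v \<bullet>c v = complex_of_real ((eucl_norm v)\<^sup>2)"
  by (simp add: eucl_norm_sq scalar_prod_def complex_norm_square atLeast0LessThan del: of_real_power)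

lemma eucl_norm_eq_0_iff:
  assumes "v \<in> carrier_vec n"
  shows "eucl_norm v = 0 \<longleftrightarrow> v = 0\<^sub>v n"
  using conjugate_square_eq_0_vec[OF assms] by (simp add: cinner_self)

lemma eucl_norm_L2_set: "eucl_norm v = L2_set (\<lambda>i. cmod (vec_index v i)) {..<dim_vec v}"
  by (simp add: eucl_norm_def L2_set_def)

lemma eucl_norm_triangle:
  assumes "v \<in> carrier_vec n" "w \<in> carrier_vec n"
  shows "eucl_norm (v + w) \<le> eucl_norm v + eucl_norm w"
proof -
  have "eucl_norm (v + w) \<le> L2_set (\<lambda>i. cmod (vec_index v i) + cmod (vec_index w i)) {..<n}"
    using assms unfolding eucl_norm_L2_set by (auto intro!: L2_set_mono norm_triangle_ineq)
  also have "\<dots> \<le> eucl_norm v + eucl_norm w"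
    using assms L2_set_triangle_ineq[of _ _ "{..<n}"] by (auto simp: eucl_norm_L2_set)
  finally show ?thesis .
qed

lemma eucl_norm_smult: "eucl_norm (c \<cdot>\<^sub>v v) = cmod c * eucl_norm v"
  unfolding eucl_norm_L2_set L2_set_right_distrib[OF norm_ge_zero]
  by (rule L2_set_cong) (auto simp: norm_mult)

definition unitary_mat :: "nat \<Rightarrow> complex mat \<Rightarrow> bool" where
  "unitary_mat n U \<longleftrightarrow> U \<in> carrier_mat n n \<and> mat_adjoint U * U = 1\<^sub>m n"

lemma unitary_matD:
  assumes "unitary_mat n U"
  shows "U \<in> carrier_mat n n" "mat_adjoint U * U = 1\<^sub>m n" "U * mat_adjoint U = 1\<^sub>m n"
  using assms mat_mult_left_right_inverse[of "mat_adjoint U" n U] by (auto simp: unitary_mat_def)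

lemma unitary_mat_adjoint: "unitary_mat n U \<Longrightarrow> unitary_mat n (mat_adjoint U)"
  by (frule unitary_matD(1), frule unitary_matD(3)) (simp add: unitary_mat_def)

lemma unitary_mat_mult:
  assumes "unitary_mat n U" "unitary_mat n W"
  shows "unitary_mat n (U * W)"
proof -
  note U = unitary_matD[OF assms(1)] and W = unitary_matD[OF assms(2)]
  have "mat_adjoint (U * W) * (U * W) = mat_adjoint W * (mat_adjoint U * U) * W"
    using U(1) W(1) by (simp add: mat_adjoint_mult[OF U(1) W(1)] assoc_mult_mat[of _ n n _ n _ n]
        mult_carrier_mat[of _ n n _ n])
  then show ?thesis using U W by (simp add: unitary_mat_def)
qed

lemma eucl_norm_unitary:
  assumes "unitary_mat n U" "v \<in> carrier_vec n"
  shows "eucl_norm (U *\<^sub>v v) = eucl_norm v"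
proof -
  note U = unitary_matD[OF assms(1)]
  have "(U *\<^sub>v v) \<bullet>c (U *\<^sub>v v) = v \<bullet>c (mat_adjoint U *\<^sub>v (U *\<^sub>v v))"
    using U assms by (intro cinner_adjoint) auto
  also have "mat_adjoint U *\<^sub>v (U *\<^sub>v v) = v"
    using U(1,2) assms(2) by (simp flip: assoc_mult_mat_vec[of _ n n _ n])
  finally have "(eucl_norm (U *\<^sub>v v))\<^sup>2 = (eucl_norm v)\<^sup>2"
    by (simp only: cinner_self of_real_eq_iff)
  then show ?thesis by simp
qed

definition diag_matrix :: "complex list \<Rightarrow> complex mat" where
  "diag_matrix ds = Matrix.mat (length ds) (length ds) (\<lambda>(i, j). if i = j then ds ! i else 0)"

text \<open>
  Complete \<open>v\<close> to a basis, orthogonalise it by Gram-Schmidt, which keeps the first vector, and divide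
  each column by its norm.  The deflation step of the spectral theorem uses this with an eigenvector.
\<close>

lemma unitary_completion:
  assumes v: "v \<in> carrier_vec n" and v0: "v \<noteq> 0\<^sub>v n"
  shows "\<exists>W c. unitary_mat n W \<and> Matrix.col W 0 = c \<cdot>\<^sub>v v"
proof -
  interpret cof_vec_space n "TYPE(complex)" .
  have n0: "0 < n"
    using v v0 by (cases n) auto
  define b where "b = basis_completion v"
  define ws where "ws = gram_schmidt n b"
  from basis_completion[OF v v0, folded b_def]
  have dist_b: "distinct b" and indep: "\<not> lin_dep (set b)" and b: "set b \<subseteq> carrier_vec n"
    and hdb: "hd b = v" and len_b: "length b = n" by auto
  from hdb len_b n0 obtain vs where bv: "b = v # vs" by (cases b) auto
  from gram_schmidt_result[OF b dist_b indep refl, folded ws_def]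
  have ws: "set ws \<subseteq> carrier_vec n" "corthogonal ws" "length ws = n"
    by (auto simp: len_b)
  have "hd ws = v"
    using gram_schmidt_hd[OF v, of vs, folded bv] by (simp add: ws_def)
  then have ws0: "ws ! 0 = v"
    using ws(3) n0 by (cases ws) auto
  have wsi: "ws ! i \<in> carrier_vec n" if "i < n" for i
    using ws that by (meson nth_mem subsetD)
  define N where "N i = complex_of_real (eucl_norm (ws ! i))" for i
  have N0: "N i \<noteq> 0" if "i < n" for i
    using corthogonalD[OF ws(2), of i i] that ws(3) by (auto simp: N_def cinner_self)
  define W where "W = Matrix.mat n n (\<lambda>(i, j). vec_index (ws ! j) i / N j)"
  have W: "W \<in> carrier_mat n n" by (simp add: W_def)
  have "mat_adjoint W * W = 1\<^sub>m n"
  proof (rule eq_matI)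
    fix i j assume "i < dim_row (1\<^sub>m n :: complex mat)" "j < dim_col (1\<^sub>m n :: complex mat)"
    then have ij: "i < n" "j < n" by auto
    have "(mat_adjoint W * W) $$ (i, j)
        = (\<Sum>k<n. cnj (vec_index (ws ! i) k / N i) * (vec_index (ws ! j) k / N j))"
      using W ij by (simp add: scalar_prod_def atLeast0LessThan W_def)
    also have "\<dots> = (ws ! j \<bullet>c ws ! i) / (N i * N j)"
      using wsi[OF ij(1)] wsi[OF ij(2)]
      by (auto simp: scalar_prod_def atLeast0LessThan sum_divide_distrib N_def intro!: sum.cong)
    also have "\<dots> = (if i = j then 1 else 0)"
    proof (cases "i = j")
      case True
      then show ?thesis using N0[OF ij(1)] by (simp add: cinner_self N_def power2_eq_square)
    next
      case False
      then show ?thesis using corthogonalD[OF ws(2), of j i] ij ws(3) by auto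
    qed
    finally show "(mat_adjoint W * W) $$ (i, j) = (1\<^sub>m n :: complex mat) $$ (i, j)"
      using ij by simp
  qed (use W in auto)
  moreover have "Matrix.col W 0 = (1 / N 0) \<cdot>\<^sub>v v"
    using v n0 by (intro eq_vecI) (auto simp: W_def ws0)
  ultimately show ?thesis using W unfolding unitary_mat_def by blast
qed

section \<open>Diagonalization of Hermitian matrices\<close>

lemma diag_matrix_carrier [simp]: "diag_matrix ds \<in> carrier_mat (length ds) (length ds)"
  by (simp add: diag_matrix_def)

lemma diag_matrix_Cons:
  "diag_matrix (d # ds) = four_block_mat (Matrix.mat 1 1 (\<lambda>_. d))
     (0\<^sub>m 1 (length ds)) (0\<^sub>m (length ds) 1) (diag_matrix ds)"
  by (rule eq_matI) (auto simp: diag_matrix_def less_Suc_eq_0_disj)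

lemma adjoint_diag_matrix: "mat_adjoint (diag_matrix ds) = diag_matrix (map cnj ds)"
  by (rule eq_matI) (auto simp: diag_matrix_def)

lemma hermitian_matD:
  assumes "hermitian_mat A"
  shows "mat_adjoint A = A"
  using assms by (simp add: hermitian_mat_def)

lemma hermitian_cong:
  fixes A W :: "complex mat"
  assumes A: "A \<in> carrier_mat n n" "hermitian_mat A" and W: "W \<in> carrier_mat n n"
  shows "hermitian_mat (mat_adjoint W * A * W)"
proof -
  have W': "mat_adjoint W \<in> carrier_mat n n" using W by simp
  have WA: "mat_adjoint W * A \<in> carrier_mat n n" using W' A by simp
  have "mat_adjoint (mat_adjoint W * A * W) = mat_adjoint W * (mat_adjoint A * W)"
    using mat_adjoint_mult[OF WA W] mat_adjoint_mult[OF W' A(1)] by simp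
  also have "\<dots> = mat_adjoint W * A * W"
    using W' A W by (simp add: hermitian_matD assoc_mult_mat[of _ n n _ n _ n])
  finally show ?thesis using W by (simp add: hermitian_mat_def)
qed

lemma unitary_conj_cancel:
  assumes U: "unitary_mat n U" and A: "A \<in> carrier_mat n n"
  shows "U * (mat_adjoint U * A * U) * mat_adjoint U = A"
proof -
  note Uc = unitary_matD(1)[OF U]
  have Uc': "mat_adjoint U \<in> carrier_mat n n" using Uc by simp
  have AU: "A * U \<in> carrier_mat n n" using A Uc by simp
  have "U * (mat_adjoint U * A * U) * mat_adjoint U = U * (mat_adjoint U * (A * U)) * mat_adjoint U"
    using A Uc Uc' by (simp add: assoc_mult_mat[of _ n n _ n _ n])
  also have "\<dots> = (U * mat_adjoint U) * (A * U) * mat_adjoint U"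
    using assoc_mult_mat[OF Uc Uc' AU] by simp
  also have "\<dots> = A * U * mat_adjoint U"
    by (simp only: unitary_matD(3)[OF U] left_mult_one_mat[OF AU])
  also have "\<dots> = A * (U * mat_adjoint U)"
    by (rule assoc_mult_mat[OF A Uc Uc'])
  also have "\<dots> = A" using unitary_matD(3)[OF U] A by simp
  finally show ?thesis .
qed

lemma unitary_four_block:
  assumes U: "unitary_mat n U"
  shows "unitary_mat (Suc n) (four_block_mat (1\<^sub>m 1) (0\<^sub>m 1 n) (0\<^sub>m n 1) U)"
    and "mat_adjoint (four_block_mat (1\<^sub>m 1) (0\<^sub>m 1 n) (0\<^sub>m n 1) U)
      = four_block_mat (1\<^sub>m 1) (0\<^sub>m 1 n) (0\<^sub>m n 1) (mat_adjoint U)"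
proof -
  note Uc = unitary_matD(1)[OF U]
  let ?F = "four_block_mat (1\<^sub>m 1) (0\<^sub>m 1 n) (0\<^sub>m n 1) U"
  have Fc: "?F \<in> carrier_mat (Suc n) (Suc n)"
    using four_block_carrier_mat[of "1\<^sub>m 1" 1 1 U n n] Uc by simp
  have Uc': "mat_adjoint U \<in> carrier_mat n n" using Uc by simp
  show adj: "mat_adjoint ?F = four_block_mat (1\<^sub>m 1) (0\<^sub>m 1 n) (0\<^sub>m n 1) (mat_adjoint U)"
    using Uc by (intro eq_matI) (auto simp: less_Suc_eq_0_disj)
  have "mat_adjoint ?F * ?F = four_block_mat (1\<^sub>m 1) (0\<^sub>m 1 n) (0\<^sub>m n 1) (1\<^sub>m n)"
    unfolding adj
    by (subst mult_four_block_mat[OF one_carrier_mat zero_carrier_mat zero_carrier_mat Uc'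
        one_carrier_mat zero_carrier_mat zero_carrier_mat Uc])
      (use Uc Uc' unitary_matD(2)[OF U] in simp)
  also have "\<dots> = 1\<^sub>m (Suc n)"
    by (rule eq_matI) auto
  finally show "unitary_mat (Suc n) ?F" using Fc by (simp add: unitary_mat_def)
qed

text \<open>
  The spectral theorem, with the eigenvalues in a prescribed order.  If the first column of a unitary
  \<open>W\<close> is an eigenvector for \<open>e\<close>, then the first column of \<open>W\<^sup>* A W\<close> is \<open>e\<close> times a unit vector, and by
  symmetry so is its first row.  The remaining block is Hermitian and its characteristic polynomial
  has the remaining roots, so induction applies to it.
\<close>

lemma hermitian_diagonalization:
  fixes A :: "complex mat"
  assumes "A \<in> carrier_mat n n" "hermitian_mat A" "char_poly A = (\<Prod>e\<leftarrow>es. [:- e, 1:])"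
    and "length es = n"
  shows "\<exists>U. unitary_mat n U \<and> A = U * diag_matrix es * mat_adjoint U"
  using assms
proof (induction es arbitrary: A n)
  case Nil
  then have "A = 1\<^sub>m n * diag_matrix [] * mat_adjoint (1\<^sub>m n)"
    by (intro eq_matI) auto
  then show ?case using Nil by (intro exI[of _ "1\<^sub>m n"]) (simp add: unitary_mat_def)
next
  case (Cons e es)
  define m where "m = length es"
  have n: "n = Suc m" using Cons.prems(4) by (simp add: m_def)
  note A = Cons.prems(1,2)
  have "eigenvalue A e"
    unfolding eigenvalue_root_char_poly[OF A(1)] Cons.prems(3) by simp
  from find_eigenvector[OF A(1) this] obtain v where v: "v \<in> carrier_vec n" "v \<noteq> 0\<^sub>v n"
    and Av: "A *\<^sub>v v = e \<cdot>\<^sub>v v" using A(1) by (auto simp: eigenvector_def)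
  obtain W c where W: "unitary_mat n W" and W0: "Matrix.col W 0 = c \<cdot>\<^sub>v v"
    using unitary_completion[OF v] by blast
  note Wc = unitary_matD(1)[OF W]
  have Wc': "mat_adjoint W \<in> carrier_mat n n" using Wc by simp
  define B where "B = mat_adjoint W * A * W"
  have Bc: "B \<in> carrier_mat n n" unfolding B_def using A(1) Wc Wc' by (intro mult_carrier_mat)
  have herm_B: "hermitian_mat B" unfolding B_def by (rule hermitian_cong[OF A Wc])
  have sim: "similar_mat B A"
    unfolding similar_mat_def
    by (rule exI, rule exI, rule similar_mat_witI[OF unitary_matD(2,3)[OF W] B_def Bc A(1) Wc' Wc])
  have wc: "Matrix.col W 0 \<in> carrier_vec n" using v by (simp add: W0)
  have WAc: "mat_adjoint W * A \<in> carrier_mat n n" using A(1) Wc' by simp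
  have col_B: "Matrix.col B 0 = e \<cdot>\<^sub>v unit_vec n 0"
  proof -
    have n0: "0 < n" using n by simp
    have "Matrix.col B 0 = mat_adjoint W *\<^sub>v (A *\<^sub>v Matrix.col W 0)"
      unfolding B_def col_mult2[OF WAc Wc n0] by (rule assoc_mult_mat_vec[OF Wc' A(1) wc])
    also have "A *\<^sub>v Matrix.col W 0 = e \<cdot>\<^sub>v Matrix.col W 0"
      using A(1) v Av by (simp add: W0 mult_mat_vec smult_smult_assoc mult.commute)
    also have "mat_adjoint W *\<^sub>v (e \<cdot>\<^sub>v Matrix.col W 0) = e \<cdot>\<^sub>v Matrix.col (mat_adjoint W * W) 0"
      unfolding col_mult2[OF Wc' Wc n0] by (rule mult_mat_vec[OF Wc' wc])
    also have "mat_adjoint W * W = 1\<^sub>m n" by (rule unitary_matD(2)[OF W])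
    finally show ?thesis using n by simp
  qed
  have B0: "B $$ (i, 0) = (if i = 0 then e else 0)" if "i < n" for i
    using arg_cong[OF col_B, of "\<lambda>v. vec_index v i"] that Bc n by auto
  have B0': "B $$ (0, i) = (if i = 0 then e else 0)" if "0 < i" "i < n" for i
    using B0[OF that(2)] mat_adjoint_index[of 0 B i] hermitian_matD[OF herm_B] Bc that by simp
  define C where "C = Matrix.mat m m (\<lambda>(i, j). B $$ (Suc i, Suc j))"
  have Cc: "C \<in> carrier_mat m m" by (simp add: C_def)
  have blk: "B = four_block_mat (Matrix.mat 1 1 (\<lambda>_. e)) (0\<^sub>m 1 m) (0\<^sub>m m 1) C"
    using Bc B0 B0' by (intro eq_matI) (auto simp: C_def n less_Suc_eq_0_disj)
  have herm_C: "hermitian_mat C"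
  proof -
    have "cnj (B $$ (j, i)) = B $$ (i, j)" if "i < n" "j < n" for i j
      using mat_adjoint_index[of i B j] hermitian_matD[OF herm_B] Bc that by simp
    then have "mat_adjoint C = C"
      by (intro eq_matI) (auto simp: C_def n)
    then show ?thesis by (simp add: hermitian_mat_def C_def)
  qed
  have e1: "char_poly (Matrix.mat 1 1 (\<lambda>_. e)) = [:- e, 1:]"
    by (simp add: char_poly_defs det_def sign_def)
  have "[:- e, 1:] * (\<Prod>e\<leftarrow>es. [:- e, 1:]) = char_poly B"
    using char_poly_similar[OF sim] Cons.prems(3) by simp
  also have "\<dots> = [:- e, 1:] * char_poly C"
    unfolding blk e1[symmetric]
    by (rule char_poly_four_block_zeros_col) (use Cc in auto)
  finally have "char_poly C = (\<Prod>e\<leftarrow>es. [:- e, 1:])"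
    by (metis mult_cancel_left pCons_eq_0_iff zero_neq_one)
  then obtain V where V: "unitary_mat m V" and CV: "C = V * diag_matrix es * mat_adjoint V"
    using Cons.IH[OF Cc herm_C] m_def by auto
  note Vc = unitary_matD(1)[OF V]
  have Vc': "mat_adjoint V \<in> carrier_mat m m" using Vc by simp
  define F where "F = four_block_mat (1\<^sub>m 1) (0\<^sub>m 1 m) (0\<^sub>m m 1) V"
  have F: "unitary_mat n F"
    and F': "mat_adjoint F = four_block_mat (1\<^sub>m 1) (0\<^sub>m 1 m) (0\<^sub>m m 1) (mat_adjoint V)"
    using unitary_four_block[OF V] by (simp_all add: F_def n)
  note Fc = unitary_matD(1)[OF F]
  have Fc': "mat_adjoint F \<in> carrier_mat n n" using Fc by simp
  have ec: "Matrix.mat 1 1 (\<lambda>_. e) \<in> carrier_mat 1 1" by simp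
  have Dc: "diag_matrix es \<in> carrier_mat m m" by (simp add: m_def)
  have Dc': "diag_matrix (e # es) \<in> carrier_mat n n" unfolding n m_def
    using diag_matrix_carrier[of "e # es"] by simp
  have VD: "V * diag_matrix es \<in> carrier_mat m m" using Vc Dc by simp
  have "F * diag_matrix (e # es)
      = four_block_mat (Matrix.mat 1 1 (\<lambda>_. e)) (0\<^sub>m 1 m) (0\<^sub>m m 1) (V * diag_matrix es)"
    unfolding F_def diag_matrix_Cons m_def[symmetric]
    by (subst mult_four_block_mat[OF one_carrier_mat zero_carrier_mat zero_carrier_mat Vc
        ec zero_carrier_mat zero_carrier_mat Dc])
      (use Vc Dc VD ec in simp)
  then have "F * diag_matrix (e # es) * mat_adjoint F = B"
    unfolding F' blk CV
    by (simp only:, subst mult_four_block_mat[OF ec zero_carrier_mat zero_carrier_mat VD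
        one_carrier_mat zero_carrier_mat zero_carrier_mat Vc'])
      (use Vc' VD ec left_mult_zero_mat[OF Vc', of 1] right_mult_zero_mat[OF VD, of 1] in simp)
  then have "A = W * (F * diag_matrix (e # es) * mat_adjoint F) * mat_adjoint W"
    using unitary_conj_cancel[OF W A(1)] by (simp add: B_def)
  also have "\<dots> = (W * F) * diag_matrix (e # es) * mat_adjoint (W * F)"
    using Wc Wc' Fc Fc' Dc'
    by (simp add: mat_adjoint_mult[OF Wc Fc] assoc_mult_mat[of _ n n _ n _ n]
        mult_carrier_mat[of _ n n _ n])
  finally show ?case using unitary_mat_mult[OF W F] by blast
qed

abbreviation real_diag :: "real list \<Rightarrow> complex mat" where
  "real_diag ds \<equiv> diag_matrix (map complex_of_real ds)"

lemma real_diag_carrier [simp]: "length ds = n \<Longrightarrow> real_diag ds \<in> carrier_mat n n"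
  using diag_matrix_carrier[of "map complex_of_real ds"] by simp

lemma real_diag_mult_vec:
  assumes "x \<in> carrier_vec (length ds)" "i < length ds"
  shows "vec_index (real_diag ds *\<^sub>v x) i = of_real (ds ! i) * vec_index x i"
proof -
  have "vec_index (real_diag ds *\<^sub>v x) i
      = (\<Sum>j<length ds. (if i = j then of_real (ds ! i) else 0) * vec_index x j)"
    using assms by (auto simp: diag_matrix_def scalar_prod_def atLeast0LessThan intro!: sum.cong)
  also have "\<dots> = (\<Sum>j<length ds. if i = j then of_real (ds ! i) * vec_index x j else 0)"
    by (rule sum.cong) auto
  also have "\<dots> = of_real (ds ! i) * vec_index x i"
    using assms by simp
  finally show ?thesis .
qed

lemma eucl_norm_real_diag:
  assumes "x \<in> carrier_vec (length ds)"
  shows "(eucl_norm (real_diag ds *\<^sub>v x))\<^sup>2 = (\<Sum>i<length ds. (ds ! i)\<^sup>2 * (cmod (vec_index x i))\<^sup>2)"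
proof -
  have "dim_vec (real_diag ds *\<^sub>v x) = length ds" by (simp add: diag_matrix_def)
  then show ?thesis
    using assms by (simp add: eucl_norm_sq real_diag_mult_vec norm_mult power_mult_distrib
        del: index_mult_mat_vec)
qed

lemma real_diag_mult:
  assumes "length es = length ds"
  shows "real_diag ds * real_diag es = real_diag (map2 (*) ds es)"
proof (rule eq_matI)
  fix i j assume "i < dim_row (real_diag (map2 (*) ds es))" "j < dim_col (real_diag (map2 (*) ds es))"
  then have ij: "i < length ds" "j < length ds" using assms by (simp_all add: diag_matrix_def)
  have "(real_diag ds * real_diag es) $$ (i, j)
      = (\<Sum>k<length ds. (if i = k then of_real (ds ! i) else 0) * (if k = j then of_real (es ! j) else 0))"
    using ij assms by (auto simp: diag_matrix_def scalar_prod_def atLeast0LessThan intro!: sum.cong)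
  also have "\<dots> = (\<Sum>k<length ds. if i = k then of_real (ds ! i) * (if k = j then of_real (es ! j) else 0) else 0)"
    by (rule sum.cong) auto
  also have "\<dots> = real_diag (map2 (*) ds es) $$ (i, j)"
    using ij assms by (simp add: diag_matrix_def)
  finally show "(real_diag ds * real_diag es) $$ (i, j) = real_diag (map2 (*) ds es) $$ (i, j)" .
qed (use assms in \<open>simp_all add: diag_matrix_def\<close>)

definition spectral_decomp :: "nat \<Rightarrow> complex mat \<Rightarrow> complex mat \<Rightarrow> real list \<Rightarrow> bool" where
  "spectral_decomp n A U ds \<longleftrightarrow>
     unitary_mat n U \<and> length ds = n \<and> A = U * real_diag ds * mat_adjoint U"

lemma spectral_decomp_carrier:
  assumes "spectral_decomp n A U ds"
  shows "A \<in> carrier_mat n n" "U \<in> carrier_mat n n" "mat_adjoint U \<in> carrier_mat n n"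
    "real_diag ds \<in> carrier_mat n n" "length ds = n" "unitary_mat n U"
  using assms by (auto simp: spectral_decomp_def dest!: unitary_matD(1) intro!: mult_carrier_mat)

lemma spectral_decomp_mult_vec:
  assumes S: "spectral_decomp n A U ds" and v: "v \<in> carrier_vec n"
  shows "A *\<^sub>v v = U *\<^sub>v (real_diag ds *\<^sub>v (mat_adjoint U *\<^sub>v v))"
proof -
  note c = spectral_decomp_carrier[OF S]
  have UD: "U * real_diag ds \<in> carrier_mat n n" using c by (intro mult_carrier_mat)
  have "A *\<^sub>v v = (U * real_diag ds * mat_adjoint U) *\<^sub>v v"
    using S by (simp add: spectral_decomp_def)
  also have "\<dots> = (U * real_diag ds) *\<^sub>v (mat_adjoint U *\<^sub>v v)"
    by (rule assoc_mult_mat_vec[OF UD c(3) v])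
  also have "\<dots> = U *\<^sub>v (real_diag ds *\<^sub>v (mat_adjoint U *\<^sub>v v))"
    by (rule assoc_mult_mat_vec[OF c(2,4) mult_mat_vec_carrier[OF c(3) v]])
  finally show ?thesis .
qed

lemma spectral_decomp_norm:
  assumes S: "spectral_decomp n A U ds" and v: "v \<in> carrier_vec n"
  shows "(eucl_norm (A *\<^sub>v v))\<^sup>2 = (\<Sum>i<n. (ds ! i)\<^sup>2 * (cmod (vec_index (mat_adjoint U *\<^sub>v v) i))\<^sup>2)"
proof -
  note c = spectral_decomp_carrier[OF S]
  have x: "mat_adjoint U *\<^sub>v v \<in> carrier_vec n" by (rule mult_mat_vec_carrier[OF c(3) v])
  have "eucl_norm (A *\<^sub>v v) = eucl_norm (real_diag ds *\<^sub>v (mat_adjoint U *\<^sub>v v))"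
    unfolding spectral_decomp_mult_vec[OF S v]
    by (rule eucl_norm_unitary[OF c(6)]) (rule mult_mat_vec_carrier[OF c(4) x])
  then show ?thesis using eucl_norm_real_diag[of "mat_adjoint U *\<^sub>v v" ds] x c(5) by simp
qed

lemma spectral_decomp_quadratic_form:
  assumes S: "spectral_decomp n A U ds" and v: "v \<in> carrier_vec n"
  shows "(A *\<^sub>v v) \<bullet>c v
    = of_real (\<Sum>i<n. ds ! i * (cmod (vec_index (mat_adjoint U *\<^sub>v v) i))\<^sup>2)"
proof -
  note c = spectral_decomp_carrier[OF S]
  define x where "x = mat_adjoint U *\<^sub>v v"
  have x: "x \<in> carrier_vec n" unfolding x_def by (rule mult_mat_vec_carrier[OF c(3) v])
  have "(A *\<^sub>v v) \<bullet>c v = (real_diag ds *\<^sub>v x) \<bullet>c x"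
    unfolding spectral_decomp_mult_vec[OF S v] x_def[symmetric]
    using cinner_adjoint[OF c(2) mult_mat_vec_carrier[OF c(4) x] v] by (simp add: x_def)
  also have "\<dots> = (\<Sum>i<n. of_real (ds ! i) * vec_index x i * cnj (vec_index x i))"
    using x c(5) real_diag_mult_vec[of x ds]
    by (auto simp del: index_mult_mat_vec simp: scalar_prod_def atLeast0LessThan intro!: sum.cong)
  also have "\<dots> = of_real (\<Sum>i<n. ds ! i * (cmod (vec_index x i))\<^sup>2)"
    by (simp add: complex_norm_square mult.assoc del: of_real_power)
  finally show ?thesis by (simp add: x_def)
qed

lemma spectral_decomp_hermitian:
  assumes S: "spectral_decomp n A U ds"
  shows "hermitian_mat A"
proof -
  note c = spectral_decomp_carrier[OF S]
  have D: "hermitian_mat (real_diag ds)"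
    by (simp add: hermitian_mat_def adjoint_diag_matrix o_def) (simp add: diag_matrix_def)
  show ?thesis
    using hermitian_cong[OF c(4) D c(3)] S by (simp add: spectral_decomp_def)
qed

lemma spectral_decomp_psd_iff:
  assumes S: "spectral_decomp n A U ds"
  shows "psd_mat A \<longleftrightarrow> (\<forall>i<n. 0 \<le> ds ! i)"
proof
  note c = spectral_decomp_carrier[OF S]
  assume psd: "psd_mat A"
  show "\<forall>i<n. 0 \<le> ds ! i"
  proof (intro allI impI)
    fix i assume i: "i < n"
    define v where "v = U *\<^sub>v unit_vec n i"
    have v: "v \<in> carrier_vec n" using c by (simp add: v_def)
    have "mat_adjoint U *\<^sub>v v = (mat_adjoint U * U) *\<^sub>v unit_vec n i"
      unfolding v_def using c by (intro assoc_mult_mat_vec[symmetric]) auto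
    then have x: "mat_adjoint U *\<^sub>v v = unit_vec n i"
      using unitary_matD(2)[OF c(6)] by simp
    have "(A *\<^sub>v v) \<bullet>c v = of_real (\<Sum>j<n. if j = i then ds ! i else 0)"
      unfolding spectral_decomp_quadratic_form[OF S v] x
      by (intro arg_cong[where f = of_real] sum.cong) (auto simp: unit_vec_def)
    then have "(A *\<^sub>v v) \<bullet>c v = of_real (ds ! i)" using i by simp
    moreover have "0 \<le> Re ((A *\<^sub>v v) \<bullet>c v)"
      using psd v c(1) by (simp add: psd_mat_def)
    ultimately show "0 \<le> ds ! i" by simp
  qed
next
  assume "\<forall>i<n. 0 \<le> ds ! i"
  then show "psd_mat A"
    using spectral_decomp_hermitian[OF S] spectral_decomp_quadratic_form[OF S]
      spectral_decomp_carrier(1)[OF S]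
    by (auto simp: psd_mat_def intro!: sum_nonneg)
qed

lemma unitary_conj_mult:
  assumes U: "unitary_mat n U" and A: "A \<in> carrier_mat n n" and B: "B \<in> carrier_mat n n"
  shows "(U * A * mat_adjoint U) * (U * B * mat_adjoint U) = U * (A * B) * mat_adjoint U"
proof -
  note Uc = unitary_matD(1)[OF U]
  have Uc': "mat_adjoint U \<in> carrier_mat n n" using Uc by simp
  have UB: "U * B \<in> carrier_mat n n" "B * mat_adjoint U \<in> carrier_mat n n" using Uc Uc' B by auto
  have UA: "U * A \<in> carrier_mat n n" using Uc A by auto
  have "(U * A * mat_adjoint U) * (U * B * mat_adjoint U)
      = U * A * (mat_adjoint U * (U * (B * mat_adjoint U)))"
    using assoc_mult_mat[OF Uc B Uc'] assoc_mult_mat[OF UA Uc' mult_carrier_mat[OF Uc UB(2)]]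
    by simp
  also have "mat_adjoint U * (U * (B * mat_adjoint U)) = B * mat_adjoint U"
    using assoc_mult_mat[OF Uc' Uc UB(2)] unitary_matD(2)[OF U] left_mult_one_mat[OF UB(2)] by simp
  also have "U * A * (B * mat_adjoint U) = U * (A * B) * mat_adjoint U"
    using assoc_mult_mat[OF UA B Uc'] assoc_mult_mat[OF Uc A B] by simp
  finally show ?thesis .
qed

text \<open>
  The diagonal form of a Hermitian matrix is Hermitian, so the roots of the characteristic polynomial
  are real and nothing is lost by taking real parts and sorting.  The sorted roots are then an
  admissible order for the diagonalization.
\<close>

lemma ordered_eigvals_spectral:
  assumes A: "A \<in> carrier_mat n n" "hermitian_mat A"
  shows "\<exists>U. spectral_decomp n A U (ordered_eigvals A)" and "sorted (rev (ordered_eigvals A))"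
    and "length (ordered_eigvals A) = n"
proof -
  obtain as where as: "char_poly A = (\<Prod>a\<leftarrow>as. [:- a, 1:])" "length as = n"
    using char_poly_factorized[OF A(1)] by blast
  obtain U where U: "unitary_mat n U" and AU: "A = U * diag_matrix as * mat_adjoint U"
    using hermitian_diagonalization[OF A as] by blast
  have Dc: "diag_matrix as \<in> carrier_mat n n" using diag_matrix_carrier[of as] as by simp
  have "mat_adjoint U * A * U = diag_matrix as"
    using unitary_conj_cancel[OF unitary_mat_adjoint[OF U] Dc] AU by simp
  then have "mat_adjoint (diag_matrix as) = diag_matrix as"
    using hermitian_matD[OF hermitian_cong[OF A unitary_matD(1)[OF U]]] by simp
  then have "cnj (as ! i) = as ! i" if "i < n" for i
    using mat_adjoint_index[of i "diag_matrix as" i] that as(2) by (simp add: diag_matrix_def)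
  then have real: "complex_of_real (Re a) = a" if "a \<in> set as" for a
    using that as(2) by (auto simp: in_set_conv_nth Reals_cnj_iff)
  have "proots (char_poly A) = mset as"
  proof -
    have "proots (\<Prod>a\<leftarrow>as. [:- a, 1:]) = mset as"
    proof (induction as)
      case (Cons a as)
      have "(\<Prod>a\<leftarrow>as. [:- a, 1:]) \<noteq> 0" by (auto simp: prod_list_zero_iff)
      then have "proots ([:- a, 1:] * (\<Prod>a\<leftarrow>as. [:- a, 1:])) = add_mset a (mset as)"
        using Cons.IH by (subst proots_mult) auto
      then show ?case by simp
    qed simp
    then show ?thesis using as by simp
  qed
  then have ds: "ordered_eigvals A = rev (sort (map Re as))"
    unfolding ordered_eigvals_def by (metis mset_map sorted_list_of_multiset_mset)
  show len: "length (ordered_eigvals A) = n" by (simp add: ds as)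
  show "sorted (rev (ordered_eigvals A))" by (simp add: ds)
  have "mset (map complex_of_real (ordered_eigvals A)) = image_mset (\<lambda>a. complex_of_real (Re a)) (mset as)"
    by (simp add: ds multiset.map_comp o_def)
  also have "\<dots> = mset as"
    using image_mset_cong[of "mset as" "\<lambda>a. complex_of_real (Re a)" "\<lambda>a. a"] real by simp
  finally have same: "mset (map complex_of_real (ordered_eigvals A)) = mset as" .
  have "(\<Prod>a\<leftarrow>xs. [:- a, 1:]) = (\<Prod>a\<in>#mset xs. [:- a, 1:])" for xs :: "complex list"
    by (simp flip: prod_mset_prod_list)
  then have "char_poly A = (\<Prod>a\<leftarrow>map complex_of_real (ordered_eigvals A). [:- a, 1:])"
    by (simp only: as(1) same)
  from hermitian_diagonalization[OF A this] len
  show "\<exists>U. spectral_decomp n A U (ordered_eigvals A)"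
    by (simp add: spectral_decomp_def)
qed

section \<open>The positive semidefinite square root\<close>

lemma psd_eigenvalues_nonneg:
  assumes "spectral_decomp n A U ds" "psd_mat A" "i < n"
  shows "0 \<le> ds ! i"
  using spectral_decomp_psd_iff[OF assms(1)] assms(2,3) by blast

lemma psd_sqrt_exists:
  assumes A: "A \<in> carrier_mat n n" "psd_mat A"
  shows "\<exists>B. B \<in> carrier_mat n n \<and> psd_mat B \<and> B * B = A"
proof -
  have "hermitian_mat A" using A by (simp add: psd_mat_def)
  then obtain U where S: "spectral_decomp n A U (ordered_eigvals A)"
    using ordered_eigvals_spectral[OF A(1)] by blast
  define ds where "ds = ordered_eigvals A"
  note S = S[folded ds_def]
  note c = spectral_decomp_carrier[OF S]
  define ss where "ss = map sqrt ds"
  have len: "length ss = n" using c by (simp add: ss_def)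
  have "map2 (*) ss ss = ds"
    using c(5) psd_eigenvalues_nonneg[OF S A(2)] by (intro nth_equalityI) (auto simp: ss_def)
  then have sq: "real_diag ss * real_diag ss = real_diag ds"
    using real_diag_mult[of ss ss] by simp
  define B where "B = U * real_diag ss * mat_adjoint U"
  have SB: "spectral_decomp n B U ss"
    using c len by (simp add: spectral_decomp_def B_def)
  have "B * B = A"
    using unitary_conj_mult[OF c(6) real_diag_carrier[OF len] real_diag_carrier[OF len]] S sq
    by (simp add: B_def spectral_decomp_def)
  moreover have "psd_mat B"
    unfolding spectral_decomp_psd_iff[OF SB]
    using psd_eigenvalues_nonneg[OF S A(2)] c(5) by (simp add: ss_def)
  ultimately show ?thesis using spectral_decomp_carrier(1)[OF SB] by blast
qed

lemma hermitian_norm_sq: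
  assumes B: "B \<in> carrier_mat n n" "hermitian_mat B" and v: "v \<in> carrier_vec n"
  shows "of_real ((eucl_norm (B *\<^sub>v v))\<^sup>2) = ((B * B) *\<^sub>v v) \<bullet>c v"
proof -
  have Bv: "B *\<^sub>v v \<in> carrier_vec n" by (rule mult_mat_vec_carrier[OF B(1) v])
  have "((B * B) *\<^sub>v v) \<bullet>c v = (B *\<^sub>v (B *\<^sub>v v)) \<bullet>c v"
    by (simp only: assoc_mult_mat_vec[OF B(1) B(1) v])
  also have "\<dots> = (B *\<^sub>v v) \<bullet>c (B *\<^sub>v v)"
    by (simp only: cinner_adjoint[OF B(1) Bv v] hermitian_matD[OF B(2)])
  finally show ?thesis by (simp only: cinner_self)
qed

text \<open>
  It suffices that every eigenvalue \<open>d\<close> of the Hermitian matrix \<open>D = B - C\<close> vanishes.  Let \<open>v\<close> be a unit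
  eigenvector for \<open>d\<close>.  From \<open>B\<^sup>2 = C\<^sup>2\<close> one gets \<open>|Bv| = |Cv|\<close>, and with \<open>Bv = Cv + dv\<close> this turns into
  \<open>d (\<langle>Bv, v\<rangle> + \<langle>Cv, v\<rangle>) = 0\<close>.  If \<open>d\<close> were not zero, both nonnegative forms would vanish, and so would
  their difference \<open>d\<close>.
\<close>

lemma psd_sqrt_unique:
  assumes B: "B \<in> carrier_mat n n" "psd_mat B" and C: "C \<in> carrier_mat n n" "psd_mat C"
    and eq: "B * B = C * C"
  shows "B = C"
proof -
  have hB: "hermitian_mat B" and hC: "hermitian_mat C" using B C by (auto simp: psd_mat_def)
  define D where "D = B - C"
  have D: "D \<in> carrier_mat n n" using B C by (auto simp: D_def)
  have entry: "cnj (M $$ (j, i)) = M $$ (i, j)"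
    if "M \<in> carrier_mat n n" "hermitian_mat M" "i < n" "j < n" for M i j
    using mat_adjoint_index[of i M j] hermitian_matD[OF that(2)] that by auto
  have "mat_adjoint D = D"
    using B(1) C(1) entry[OF B(1) hB] entry[OF C(1) hC] by (intro eq_matI) (auto simp: D_def)
  then have hD: "hermitian_mat D" using D by (simp add: hermitian_mat_def)
  obtain U ds where S: "spectral_decomp n D U ds"
    using ordered_eigvals_spectral(1)[OF D hD] by blast
  note c = spectral_decomp_carrier[OF S]
  have zero: "ds ! i = 0" if i: "i < n" for i
  proof (rule ccontr)
    assume d0: "ds ! i \<noteq> 0"
    define d where "d = ds ! i"
    define v where "v = U *\<^sub>v unit_vec n i"
    have v: "v \<in> carrier_vec n" using c by (simp add: v_def)
    have "mat_adjoint U *\<^sub>v v = (mat_adjoint U * U) *\<^sub>v unit_vec n i"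
      unfolding v_def using c by (intro assoc_mult_mat_vec[symmetric]) auto
    then have x: "mat_adjoint U *\<^sub>v v = unit_vec n i"
      using unitary_matD(2)[OF c(6)] by simp
    have "real_diag ds *\<^sub>v unit_vec n i = of_real d \<cdot>\<^sub>v unit_vec n i"
      using c i real_diag_mult_vec[of "unit_vec n i" ds]
      by (intro eq_vecI) (auto simp del: index_mult_mat_vec simp: unit_vec_def d_def diag_matrix_def)
    then have Dv: "D *\<^sub>v v = of_real d \<cdot>\<^sub>v v"
      unfolding spectral_decomp_mult_vec[OF S v] x
      using mult_mat_vec[OF c(2) unit_vec_carrier] by (simp add: v_def)
    define b where "b = B *\<^sub>v v"
    define c' where "c' = C *\<^sub>v v"
    have bc: "b \<in> carrier_vec n" "c' \<in> carrier_vec n"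
      using mult_mat_vec_carrier[OF B(1) v] mult_mat_vec_carrier[OF C(1) v] by (simp_all add: b_def c'_def)
    have diff: "b - c' = of_real d \<cdot>\<^sub>v v"
      using minus_mult_distrib_mat_vec[OF B(1) C(1) v] Dv by (simp add: b_def c'_def D_def)
    \<comment> \<open>Working in coordinates avoids expanding complex inner products: \<open>d\<close> is real, so the mixed
      terms combine to real parts.\<close>
    have pt: "vec_index b j = vec_index c' j + of_real d * vec_index v j" if "j < n" for j
      using arg_cong[OF diff, of "\<lambda>w. vec_index w j"] bc v that by (simp add: diff_eq_eq)
    have re: "Re (w \<bullet>c v) = (\<Sum>j<n. Re (vec_index w j * cnj (vec_index v j)))" for w
      using v by (simp add: scalar_prod_def atLeast0LessThan)
    have nb: "0 \<le> Re (b \<bullet>c v)" and nc: "0 \<le> Re (c' \<bullet>c v)"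
      using B C v by (auto simp: psd_mat_def b_def c'_def)
    have "(eucl_norm b)\<^sup>2 = (eucl_norm c')\<^sup>2"
      using hermitian_norm_sq[OF B(1) hB v] hermitian_norm_sq[OF C(1) hC v] eq
      by (metis b_def c'_def of_real_eq_iff)
    then have "0 = (\<Sum>j<n. (cmod (vec_index b j))\<^sup>2 - (cmod (vec_index c' j))\<^sup>2)"
      using bc by (simp add: eucl_norm_sq sum_subtractf)
    also have "\<dots> = (\<Sum>j<n. d * (Re (vec_index b j * cnj (vec_index v j))
        + Re (vec_index c' j * cnj (vec_index v j))))"
      by (rule sum.cong) (simp_all add: pt cmod_power2, simp add: algebra_simps power2_eq_square)
    also have "\<dots> = d * (Re (b \<bullet>c v) + Re (c' \<bullet>c v))"
      by (simp add: re sum.distrib flip: sum_distrib_left)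
    finally have "Re (b \<bullet>c v) = 0" "Re (c' \<bullet>c v) = 0"
      using d0 nb nc by (auto simp: d_def)
    moreover have "Re (b \<bullet>c v) = Re (c' \<bullet>c v) + d * (eucl_norm v)\<^sup>2"
    proof -
      have "Re (b \<bullet>c v) = (\<Sum>j<n. Re (vec_index c' j * cnj (vec_index v j)) + d * (cmod (vec_index v j))\<^sup>2)"
        unfolding re
        by (rule sum.cong) (simp_all add: pt cmod_power2, simp add: algebra_simps power2_eq_square)
      also have "\<dots> = Re (c' \<bullet>c v) + d * (eucl_norm v)\<^sup>2"
        using v by (simp add: re eucl_norm_sq sum.distrib sum_distrib_left)
      finally show ?thesis .
    qed
    moreover have "eucl_norm v = 1"
    proof -
      have "(eucl_norm v)\<^sup>2 = (eucl_norm (unit_vec n i))\<^sup>2"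
        using eucl_norm_unitary[OF c(6), of "unit_vec n i"] by (simp add: v_def)
      also have "\<dots> = (\<Sum>j<n. if j = i then 1 else 0)"
        unfolding eucl_norm_sq by (rule sum.cong) (auto simp: unit_vec_def)
      finally show ?thesis using i by (simp add: power2_eq_1_iff) (metis eucl_norm_nonneg not_one_le_zero neg_0_le_iff_le)
    qed
    ultimately show False using d0 by (simp add: d_def)
  qed
  have "real_diag ds = 0\<^sub>m n n"
    using c(5) zero by (intro eq_matI) (auto simp: diag_matrix_def)
  then have D0: "D = 0\<^sub>m n n"
    using S c by (simp add: spectral_decomp_def)
  have "B $$ (i, j) = C $$ (i, j)" if "i < n" "j < n" for i j
    using arg_cong[OF D0, of "\<lambda>M. M $$ (i, j)"] that B(1) C(1) by (simp add: D_def)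
  then show ?thesis
    using B(1) C(1) by (intro eq_matI) auto
qed

lemma psd_sqrt:
  assumes A: "A \<in> carrier_mat n n" "psd_mat A"
  shows "psd_sqrt A \<in> carrier_mat n n" "psd_mat (psd_sqrt A)" "psd_sqrt A * psd_sqrt A = A"
proof -
  have "\<exists>!B. B \<in> carrier_mat (dim_row A) (dim_row A) \<and> psd_mat B \<and> B * B = A"
    using psd_sqrt_exists[OF A] psd_sqrt_unique A(1) by (metis carrier_matD(1))
  from theI'[OF this] show "psd_sqrt A \<in> carrier_mat n n" "psd_mat (psd_sqrt A)" "psd_sqrt A * psd_sqrt A = A"
    using A(1) by (auto simp: psd_sqrt_def)
qed

lemma psd_adjoint_mult:
  assumes A: "A \<in> carrier_mat n n"
  shows "psd_mat (mat_adjoint A * A)"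
proof -
  have A': "mat_adjoint A \<in> carrier_mat n n" using A by simp
  have "Re (((mat_adjoint A * A) *\<^sub>v v) \<bullet>c v) = (eucl_norm (A *\<^sub>v v))\<^sup>2" if v: "v \<in> carrier_vec n" for v
    using cinner_adjoint[OF A' mult_mat_vec_carrier[OF A v] v]
    by (simp add: assoc_mult_mat_vec[OF A' A v] cinner_self)
  then show ?thesis
    using A mat_adjoint_mult[OF A' A] by (simp add: psd_mat_def hermitian_mat_def)
qed

text \<open>
  Both sides square to \<open>\<langle>A\<^sup>*Av, v\<rangle>\<close>.  This identity lets statements about singular values be proved
  without a singular value decomposition.
\<close>

lemma eucl_norm_psd_sqrt:
  assumes A: "A \<in> carrier_mat n n" and v: "v \<in> carrier_vec n"
  shows "eucl_norm (psd_sqrt (mat_adjoint A * A) *\<^sub>v v) = eucl_norm (A *\<^sub>v v)"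
proof -
  have A': "mat_adjoint A \<in> carrier_mat n n" using A by simp
  have AA: "mat_adjoint A * A \<in> carrier_mat n n" by (rule mult_carrier_mat[OF A' A])
  note S = psd_sqrt[OF AA psd_adjoint_mult[OF A]]
  have "hermitian_mat (psd_sqrt (mat_adjoint A * A))" using S(2) by (simp add: psd_mat_def)
  from hermitian_norm_sq[OF S(1) this v]
  have "of_real ((eucl_norm (psd_sqrt (mat_adjoint A * A) *\<^sub>v v))\<^sup>2) = (A *\<^sub>v v) \<bullet>c (A *\<^sub>v v)"
    using cinner_adjoint[OF A' mult_mat_vec_carrier[OF A v] v]
    by (simp add: S(3) assoc_mult_mat_vec[OF A' A v])
  then have "(eucl_norm (psd_sqrt (mat_adjoint A * A) *\<^sub>v v))\<^sup>2 = (eucl_norm (A *\<^sub>v v))\<^sup>2"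
    by (simp only: cinner_self of_real_eq_iff)
  then show ?thesis by simp
qed

section \<open>Perturbation of eigenvalues and singular values\<close>

text \<open>
  The first \<open>l + 1\<close> columns of \<open>U\<close> span a space of dimension \<open>l + 1\<close>, and orthogonality to the first
  \<open>l\<close> columns of \<open>W\<close> imposes only \<open>l\<close> linear conditions.  The homogeneous system is made square by
  adding a zero row, whence its determinant is zero and it has a nontrivial solution.
\<close>

lemma exists_common_vector:
  assumes U: "unitary_mat n U" and W: "unitary_mat n W" and k: "l < n"
  shows "\<exists>v. v \<in> carrier_vec n \<and> v \<noteq> 0\<^sub>v n
    \<and> (\<forall>i<n. l < i \<longrightarrow> vec_index (mat_adjoint U *\<^sub>v v) i = 0)
    \<and> (\<forall>i<l. vec_index (mat_adjoint W *\<^sub>v v) i = 0)"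
proof -
  note Uc = unitary_matD(1)[OF U] and Wc = unitary_matD(1)[OF W]
  have Uc': "mat_adjoint U \<in> carrier_mat n n" and Wc': "mat_adjoint W \<in> carrier_mat n n"
    using Uc Wc by auto
  define G where "G = mat_adjoint W * U"
  have G: "G \<in> carrier_mat n n" unfolding G_def by (rule mult_carrier_mat[OF Wc' Uc])
  define g where "g i = Matrix.vec (Suc l) (\<lambda>j. G $$ (i, j))" for i
  define C where "C = mat\<^sub>r (Suc l) (Suc l) (\<lambda>i. if i = l then 0\<^sub>v (Suc l) else g i)"
  have C: "C \<in> carrier_mat (Suc l) (Suc l)" by (simp add: C_def)
  have "det C = 0"
    unfolding C_def by (rule det_row_0) (auto simp: g_def)
  then obtain x where x: "x \<in> carrier_vec (Suc l)" "x \<noteq> 0\<^sub>v (Suc l)" "C *\<^sub>v x = 0\<^sub>v (Suc l)"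
    using det_0_iff_vec_prod_zero[OF C] by blast
  \<comment> \<open>Coordinates with respect to \<open>U\<close> of the vector to be found, padded with zeros.\<close>
  define y where "y = Matrix.vec n (\<lambda>i. if i < Suc l then vec_index x i else 0)"
  have y: "y \<in> carrier_vec n" by (simp add: y_def)
  have "y \<noteq> 0\<^sub>v n"
  proof
    assume y0: "y = 0\<^sub>v n"
    have "vec_index x i = 0" if "i < Suc l" for i
      using arg_cong[OF y0, of "\<lambda>v. vec_index v i"] that k by (simp add: y_def)
    then have "x = 0\<^sub>v (Suc l)" using x(1) by (intro eq_vecI) auto
    then show False using x(2) by simp
  qed
  define v where "v = U *\<^sub>v y"
  have v: "v \<in> carrier_vec n" unfolding v_def by (rule mult_mat_vec_carrier[OF Uc y])
  have Uv: "mat_adjoint U *\<^sub>v v = y"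
    using assoc_mult_mat_vec[OF Uc' Uc y] unitary_matD(2)[OF U] y by (simp add: v_def)
  have Wv: "mat_adjoint W *\<^sub>v v = G *\<^sub>v y"
    using assoc_mult_mat_vec[OF Wc' Uc y] by (simp add: v_def G_def)
  have "v \<noteq> 0\<^sub>v n"
    using \<open>y \<noteq> 0\<^sub>v n\<close> eucl_norm_unitary[OF U y] eucl_norm_eq_0_iff[OF y] eucl_norm_eq_0_iff[OF v]
    by (simp add: v_def)
  moreover have "vec_index (mat_adjoint W *\<^sub>v v) i = 0" if "i < l" for i
  proof -
    have "vec_index (G *\<^sub>v y) i = (\<Sum>j<n. G $$ (i, j) * vec_index y j)"
      using G y that k by (simp add: scalar_prod_def atLeast0LessThan)
    also have "\<dots> = (\<Sum>j<Suc l. G $$ (i, j) * vec_index y j)"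
      using k by (intro sum.mono_neutral_right) (auto simp: y_def)
    also have "\<dots> = vec_index (C *\<^sub>v x) i"
      using C x(1) that k by (auto simp: scalar_prod_def atLeast0LessThan C_def g_def y_def intro!: sum.cong)
    also have "\<dots> = 0" using x(3) that by simp
    finally show ?thesis by (simp only: Wv)
  qed
  moreover have "vec_index (mat_adjoint U *\<^sub>v v) i = 0" if "i < n" "l < i" for i
    unfolding Uv using that by (simp add: y_def)
  ultimately show ?thesis using v by blast
qed

lemma nth_eigval_antimono:
  assumes A: "A \<in> carrier_mat n n" "hermitian_mat A" and "1 \<le> i" "i \<le> j" "j \<le> n"
  shows "nth_eigval A j \<le> nth_eigval A i"
proof -
  note len = ordered_eigvals_spectral(3)[OF A]
  have "ordered_eigvals A ! (j - 1) \<le> ordered_eigvals A ! (i - 1)"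
    using sorted_rev_nth_mono[OF ordered_eigvals_spectral(2)[OF A], of "i - 1" "j - 1"] assms len
    by simp
  then show ?thesis using assms by (simp add: nth_eigval_def)
qed

text \<open>
  On the span of the eigenvectors of \<open>A\<close> to its \<open>k\<close> largest eigenvalues, \<open>A\<close> stretches by at least its
  \<open>k\<close>-th eigenvalue; on the span of the eigenvectors of \<open>B\<close> to the eigenvalues from the \<open>k\<close>-th on, \<open>B\<close>
  stretches by at most its \<open>k\<close>-th eigenvalue.  A nonzero common vector of the two spans compares
  the two numbers.  Nonnegative eigenvalues are needed, since norms see only absolute values.
\<close>

lemma nth_eigval_perturbation:
  assumes A: "A \<in> carrier_mat n n" "psd_mat A" and B: "B \<in> carrier_mat n n" "psd_mat B"
    and le: "\<And>v. v \<in> carrier_vec n \<Longrightarrow> eucl_norm (A *\<^sub>v v) \<le> eucl_norm (B *\<^sub>v v) + c * eucl_norm v"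
    and k: "1 \<le> k" "k \<le> n"
  shows "nth_eigval A k \<le> nth_eigval B k + c"
proof -
  have hA: "hermitian_mat A" and hB: "hermitian_mat B" using A B by (auto simp: psd_mat_def)
  obtain U where SA: "spectral_decomp n A U (ordered_eigvals A)"
    using ordered_eigvals_spectral(1)[OF A(1) hA] by blast
  obtain W where SB: "spectral_decomp n B W (ordered_eigvals B)"
    using ordered_eigvals_spectral(1)[OF B(1) hB] by blast
  define l where "l = k - 1"
  have l: "l < n" using k by (simp add: l_def)
  define a where "a = nth_eigval A k"
  define b where "b = nth_eigval B k"
  have eA: "nth_eigval A (Suc i) = ordered_eigvals A ! i" if "i < n" for i
    using A that by (simp add: nth_eigval_def)
  have eB: "nth_eigval B (Suc i) = ordered_eigvals B ! i" if "i < n" for i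
    using B that by (simp add: nth_eigval_def)
  have a0: "0 \<le> a" and b0: "0 \<le> b"
    using eA[OF l] eB[OF l] k psd_eigenvalues_nonneg[OF SA A(2) l] psd_eigenvalues_nonneg[OF SB B(2) l]
    by (simp_all add: a_def b_def l_def)
  obtain v where v: "v \<in> carrier_vec n" "v \<noteq> 0\<^sub>v n"
    and Uv: "\<And>i. i < n \<Longrightarrow> l < i \<Longrightarrow> vec_index (mat_adjoint U *\<^sub>v v) i = 0"
    and Wv: "\<And>i. i < l \<Longrightarrow> vec_index (mat_adjoint W *\<^sub>v v) i = 0"
    using exists_common_vector[OF spectral_decomp_carrier(6)[OF SA] spectral_decomp_carrier(6)[OF SB] l]
    by blast
  have norm_eq: "(eucl_norm v)\<^sup>2 = (\<Sum>i<n. (cmod (vec_index (mat_adjoint V *\<^sub>v v) i))\<^sup>2)"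
    if "unitary_mat n V" for V
    using eucl_norm_unitary[OF unitary_mat_adjoint[OF that] v(1)] unitary_matD(1)[OF that]
      eucl_norm_sq[of "mat_adjoint V *\<^sub>v v"] by (simp del: index_mult_mat_vec)
  have "a\<^sup>2 * (eucl_norm v)\<^sup>2 \<le> (eucl_norm (A *\<^sub>v v))\<^sup>2"
    unfolding spectral_decomp_norm[OF SA v(1)] norm_eq[OF spectral_decomp_carrier(6)[OF SA]] sum_distrib_left
  proof (rule sum_mono)
    fix i assume "i \<in> {..<n}"
    then have i: "i < n" by simp
    show "a\<^sup>2 * (cmod (vec_index (mat_adjoint U *\<^sub>v v) i))\<^sup>2
      \<le> (ordered_eigvals A ! i)\<^sup>2 * (cmod (vec_index (mat_adjoint U *\<^sub>v v) i))\<^sup>2"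
    proof (cases "l < i")
      case True
      then show ?thesis using Uv[OF i] by simp
    next
      case False
      then have "a \<le> ordered_eigvals A ! i"
        using nth_eigval_antimono[OF A(1) hA, of "Suc i" k] eA[OF i] k by (simp add: a_def l_def)
      then show ?thesis using a0 by (intro mult_right_mono power_mono) auto
    qed
  qed
  then have lower: "a * eucl_norm v \<le> eucl_norm (A *\<^sub>v v)"
    using a0 by (simp add: power_mult_distrib[symmetric] power2_le_iff_abs_le)
  have "(eucl_norm (B *\<^sub>v v))\<^sup>2 \<le> b\<^sup>2 * (eucl_norm v)\<^sup>2"
    unfolding spectral_decomp_norm[OF SB v(1)] norm_eq[OF spectral_decomp_carrier(6)[OF SB]] sum_distrib_left
  proof (rule sum_mono)
    fix i assume "i \<in> {..<n}"
    then have i: "i < n" by simp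
    show "(ordered_eigvals B ! i)\<^sup>2 * (cmod (vec_index (mat_adjoint W *\<^sub>v v) i))\<^sup>2
      \<le> b\<^sup>2 * (cmod (vec_index (mat_adjoint W *\<^sub>v v) i))\<^sup>2"
    proof (cases "i < l")
      case True
      then show ?thesis using Wv by simp
    next
      case False
      then have "ordered_eigvals B ! i \<le> b"
        using nth_eigval_antimono[OF B(1) hB, of k "Suc i"] eB[OF i] k i by (simp add: b_def l_def)
      then show ?thesis
        using psd_eigenvalues_nonneg[OF SB B(2) i] by (intro mult_right_mono power_mono) auto
    qed
  qed
  then have upper: "eucl_norm (B *\<^sub>v v) \<le> b * eucl_norm v"
    using b0 by (simp add: power_mult_distrib[symmetric] power2_le_iff_abs_le)
  have "0 < eucl_norm v"
    using eucl_norm_eq_0_iff[OF v(1)] v(2) eucl_norm_nonneg[of v] by linarith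
  moreover have "a * eucl_norm v \<le> (b + c) * eucl_norm v"
    using lower upper le[OF v(1)] by (simp add: distrib_right)
  ultimately show ?thesis by (simp add: a_def b_def)
qed

text \<open>
  The supremum of a set of reals is an upper bound only if the set is bounded above; a crude bound by
  the sum of all \<open>|A\<^sub>i\<^sub>j|\<close> is enough.  The rest is rescaling.
\<close>

lemma eucl_norm_mult_le_op_norm:
  assumes A: "A \<in> carrier_mat n m" and v: "v \<in> carrier_vec m"
  shows "eucl_norm (A *\<^sub>v v) \<le> op_norm A * eucl_norm v"
proof (cases "v = 0\<^sub>v m")
  case True
  have "A *\<^sub>v 0\<^sub>v m = 0\<^sub>v n" using A by (intro eq_vecI) auto
  then show ?thesis using True by (simp add: eucl_norm_def)
next
  case False
  let ?S = "{v \<in> carrier_vec (dim_col A). eucl_norm v = 1}"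
  have bdd: "bdd_above ((\<lambda>v. eucl_norm (A *\<^sub>v v)) ` ?S)"
  proof (rule bdd_aboveI2)
    fix u assume u: "u \<in> ?S"
    have u1: "cmod (vec_index u j) \<le> 1" if "j < m" for j
      using u A that member_le_L2_set[of "{..<m}" j "\<lambda>i. cmod (vec_index u i)"]
      by (auto simp: eucl_norm_L2_set)
    have "eucl_norm (A *\<^sub>v u) \<le> (\<Sum>i<n. cmod (vec_index (A *\<^sub>v u) i))"
      using A unfolding eucl_norm_L2_set by (auto intro: L2_set_le_sum simp del: index_mult_mat_vec)
    also have "\<dots> \<le> (\<Sum>i<n. \<Sum>j<m. cmod (A $$ (i, j)))"
    proof (rule sum_mono)
      fix i assume "i \<in> {..<n}"
      then have "cmod (vec_index (A *\<^sub>v u) i) = cmod (\<Sum>j<m. A $$ (i, j) * vec_index u j)"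
        using A u by (auto simp: scalar_prod_def atLeast0LessThan intro!: arg_cong[where f = cmod] sum.cong)
      also have "\<dots> \<le> (\<Sum>j<m. cmod (A $$ (i, j)))"
        using u1 by (intro sum_norm_le) (auto simp: norm_mult intro!: mult_left_le)
      finally show "cmod (vec_index (A *\<^sub>v u) i) \<le> (\<Sum>j<m. cmod (A $$ (i, j)))" .
    qed
    finally show "eucl_norm (A *\<^sub>v u) \<le> (\<Sum>i<n. \<Sum>j<m. cmod (A $$ (i, j)))" .
  qed
  have pos: "0 < eucl_norm v"
    using eucl_norm_eq_0_iff[OF v] False eucl_norm_nonneg[of v] by linarith
  define u where "u = of_real (1 / eucl_norm v) \<cdot>\<^sub>v v"
  have "eucl_norm u = 1" "u \<in> carrier_vec (dim_col A)"
    using pos v A by (auto simp: u_def eucl_norm_smult norm_divide)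
  then have "eucl_norm (A *\<^sub>v u) \<le> op_norm A"
    unfolding op_norm_def by (intro cSUP_upper[OF _ bdd]) auto
  moreover have "eucl_norm (A *\<^sub>v u) = eucl_norm (A *\<^sub>v v) / eucl_norm v"
    using pos unfolding u_def mult_mat_vec[OF A v] eucl_norm_smult by (simp add: norm_divide)
  ultimately show ?thesis using pos by (simp add: divide_le_eq)
qed

section \<open>Rank selection near a positive semidefinite matrix\<close>

lemma selected_rank_eqI:
  assumes A: "A \<in> carrier_mat n n" and k: "1 \<le> k" "k \<le> n"
    and ge: "sqrt \<nu> \<le> nth_singval A k"
    and less: "k < n \<Longrightarrow> nth_singval A (k + 1) < sqrt \<nu>"
  shows "selected_rank \<nu> A = k"
proof -
  define K where "K = {j \<in> {1..dim_row A}. nth_singval A j \<ge> sqrt \<nu>}"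
  have AA: "mat_adjoint A * A \<in> carrier_mat n n" using A by (intro mult_carrier_mat) auto
  note S = psd_sqrt[OF AA psd_adjoint_mult[OF A]]
  have herm: "hermitian_mat (psd_sqrt (mat_adjoint A * A))" using S(2) by (simp add: psd_mat_def)
  have "k \<in> K" using A k ge by (simp add: K_def)
  moreover have "j \<le> k" if "j \<in> K" for j
  proof (rule ccontr)
    assume "\<not> j \<le> k"
    then have j: "k + 1 \<le> j" "j \<le> n" "sqrt \<nu> \<le> nth_singval A j" using that A by (auto simp: K_def)
    then have "nth_singval A j \<le> nth_singval A (k + 1)"
      unfolding nth_singval_def by (intro nth_eigval_antimono[OF S(1) herm]) auto
    then show False using less j by simp
  qed
  moreover have "finite K" by (simp add: K_def)
  ultimately have "Max K = k" "K \<noteq> {}" by (auto intro: Max_eqI)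
  then show ?thesis unfolding selected_rank_def Let_def K_def[symmetric] by simp
qed

lemma singval_eigval_perturbation:
  assumes A: "A \<in> carrier_mat n n" and P: "P \<in> carrier_mat n n" "psd_mat P"
    and k: "1 \<le> k" "k \<le> n"
  shows "nth_eigval P k \<le> nth_singval A k + op_norm (A - P)"
    and "nth_singval A k \<le> nth_eigval P k + op_norm (A - P)"
proof -
  have AA: "mat_adjoint A * A \<in> carrier_mat n n" using A by (intro mult_carrier_mat) auto
  note S = psd_sqrt[OF AA psd_adjoint_mult[OF A]]
  have D: "A - P \<in> carrier_mat n n" using A P by auto
  have *: "eucl_norm (P *\<^sub>v v) \<le> eucl_norm (A *\<^sub>v v) + op_norm (A - P) * eucl_norm v"
    "eucl_norm (A *\<^sub>v v) \<le> eucl_norm (P *\<^sub>v v) + op_norm (A - P) * eucl_norm v"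
    if v: "v \<in> carrier_vec n" for v
  proof -
    define d where "d = (A - P) *\<^sub>v v"
    have c: "A *\<^sub>v v \<in> carrier_vec n" "P *\<^sub>v v \<in> carrier_vec n" "d \<in> carrier_vec n"
      unfolding d_def by (rule mult_mat_vec_carrier[OF _ v], fact)+
    have d: "d = A *\<^sub>v v - P *\<^sub>v v"
      unfolding d_def by (rule minus_mult_distrib_mat_vec[OF A P(1) v])
    have le: "eucl_norm d \<le> op_norm (A - P) * eucl_norm v"
      unfolding d_def by (rule eucl_norm_mult_le_op_norm[OF D v])
    have 1: "A *\<^sub>v v = P *\<^sub>v v + d" and 2: "P *\<^sub>v v = A *\<^sub>v v + (- 1) \<cdot>\<^sub>v d"
      unfolding d using c A P(1) by (auto intro!: eq_vecI simp del: index_mult_mat_vec)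
    show "eucl_norm (A *\<^sub>v v) \<le> eucl_norm (P *\<^sub>v v) + op_norm (A - P) * eucl_norm v"
      using eucl_norm_triangle[OF c(2,3)] le 1 by simp
    show "eucl_norm (P *\<^sub>v v) \<le> eucl_norm (A *\<^sub>v v) + op_norm (A - P) * eucl_norm v"
      using eucl_norm_triangle[OF c(1), of "(- 1) \<cdot>\<^sub>v d"] c(3) le 2 eucl_norm_smult[of "- 1" d] by simp
  qed
  show "nth_eigval P k \<le> nth_singval A k + op_norm (A - P)"
    unfolding nth_singval_def
    by (rule nth_eigval_perturbation[OF P S(1,2) _ k]) (simp add: eucl_norm_psd_sqrt[OF A] *)
  show "nth_singval A k \<le> nth_eigval P k + op_norm (A - P)"
    unfolding nth_singval_def
    by (rule nth_eigval_perturbation[OF S(1,2) P _ k]) (simp add: eucl_norm_psd_sqrt[OF A] *)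
qed

text \<open>
  The gap condition places the \<open>k\<close>-th and the next eigenvalue of \<open>P\<close> on the two sides of \<open>\<surd>\<nu>\<close>, each
  at a distance larger than \<open>\<delta> \<surd>\<nu>\<close>.  Replacing \<open>P\<close> by \<open>A\<close> moves them by less than that, so neither
  crosses the threshold.
\<close>

lemma selected_rank_of_close_matrix:
  assumes A: "A \<in> carrier_mat n n" and P: "P \<in> carrier_mat n n" "psd_mat P"
    and k: "1 \<le> k" "k \<le> n"
    and gap: "nth_eigval P k > (1 + \<delta>) * sqrt \<nu>" "nth_eigval P (k + 1) < (1 - \<delta>) * sqrt \<nu>"
    and close: "op_norm (A - P) < \<delta> * sqrt \<nu>"
  shows "selected_rank \<nu> A = k"
proof (rule selected_rank_eqI[OF A k])
  show "sqrt \<nu> \<le> nth_singval A k"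
    using singval_eigval_perturbation(1)[OF A P k] gap(1) close by (simp add: algebra_simps)
  show "nth_singval A (k + 1) < sqrt \<nu>" if "k < n"
    using singval_eigval_perturbation(2)[OF A P, of "k + 1"] that gap(2) close
    by (simp add: algebra_simps)
qed

section \<open>Events defined by the estimator\<close>

lemma finite_settings: "finite (settings n)"
  unfolding settings_def
  using finite_lists_length_eq[of "{PauliX, PauliY, PauliZ}" n] by (simp add: conj_commute)

text \<open>
  The estimator sees only the finitely many outcomes \<open>R a i \<omega>\<close> with \<open>a\<close> a setting and \<open>1 \<le> i \<le> m\<close>.
  Two random families, possibly on different probability spaces, are allowed so that the estimator
  can be rewritten as a function of the tuple of outcomes.
\<close>

lemma rho_hat_cong:
  assumes "\<And>a i. a \<in> settings n \<Longrightarrow> i \<in> {1..m} \<Longrightarrow> R a i \<omega> = R' a i \<omega>'"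
  shows "rho_hat n m R \<omega> = rho_hat n m R' \<omega>'"
proof -
  have "p_hat m R r a \<omega> = p_hat m R' r a \<omega>'" if "a \<in> settings n" for r a
    unfolding p_hat_def using assms[OF that] by (intro arg_cong2[where f = "(*)"] sum.cong) auto
  then have "rho_hat_coeff n m R b \<omega> = rho_hat_coeff n m R' b \<omega>'" for b
    unfolding rho_hat_coeff_def by (intro arg_cong2[where f = "(*)"] sum.cong) auto
  then show ?thesis by (simp add: rho_hat_def)
qed

text \<open>
  The tuple of outcomes is a random element of a finite product of countable discrete spaces.  Such a
  product is again discrete, so every property of the tuple is an event, however irregular the
  operator norm or the selected rank may be as functions of the matrix.
\<close>

lemma sets_rho_hat:
  assumes meas: "\<And>a i. a \<in> settings n \<Longrightarrow> i \<in> {1..m} \<Longrightarrow> R a i \<in> measurable M (count_space (outcomes n))"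
  shows "{\<omega> \<in> space M. Q (rho_hat n m R \<omega>)} \<in> sets M"
proof -
  define I where "I = settings n \<times> {1..m}"
  define T where "T \<omega> = (\<lambda>x\<in>I. R (fst x) (snd x) \<omega>)" for \<omega>
  define F where "F f = rho_hat n m (\<lambda>a i _. f (a, i)) ()" for f
  have "T \<in> measurable M (Pi\<^sub>M I (\<lambda>_. count_space (outcomes n)))"
    unfolding T_def by (rule measurable_restrict) (auto simp: I_def meas)
  also have "Pi\<^sub>M I (\<lambda>_. count_space (outcomes n)) = count_space (PiE I (\<lambda>_. outcomes n))"
    by (rule count_space_PiM_finite) (auto simp: I_def finite_settings)
  finally have T: "T \<in> measurable M (count_space (PiE I (\<lambda>_. outcomes n)))" .
  have "{\<omega> \<in> space M. Q (rho_hat n m R \<omega>)}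
      = T -` {f \<in> PiE I (\<lambda>_. outcomes n). Q (F f)} \<inter> space M"
  proof -
    have "rho_hat n m R \<omega> = F (T \<omega>)" for \<omega>
      unfolding F_def by (rule rho_hat_cong) (auto simp: T_def I_def)
    then show ?thesis using measurable_space[OF T] by auto
  qed
  also have "\<dots> \<in> sets M" by (rule measurable_sets[OF T]) auto
  finally show ?thesis .
qed

theorem corollary6:
  fixes M :: "'w measure"
    and R :: "pauli list \<Rightarrow> nat \<Rightarrow> 'w \<Rightarrow> int list"
    and \<rho> :: "complex mat"
    and n m k :: nat
    and \<nu> \<delta> :: real
  assumes "prob_space M"
    and "n \<ge> 1" and "m \<ge> 1"
    and "density_matrix n \<rho>"
    and "prob_space.indep_vars M (\<lambda>_. count_space (outcomes n)) (\<lambda>(a, i). R a i)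
           (settings n \<times> {1..m})"
    and "\<And>a i r. a \<in> settings n \<Longrightarrow> i \<in> {1..m} \<Longrightarrow> r \<in> outcomes n \<Longrightarrow>
           complex_of_real (measure M {\<omega> \<in> space M. R a i \<omega> = r}) = mtrace (\<rho> * proj a r)"
    and "\<nu> > 0"
    and "k \<in> {1..2 ^ n}"
    and "0 < \<delta>" and "\<delta> \<le> 1"
    and "nth_eigval \<rho> k > (1 + \<delta>) * sqrt \<nu>"
    and "nth_eigval \<rho> (k + 1) < (1 - \<delta>) * sqrt \<nu>"
  shows "measure M {\<omega> \<in> space M. selected_rank \<nu> (rho_hat n m R \<omega>) = k}
           \<ge> 1 - measure M {\<omega> \<in> space M. op_norm (rho_hat n m R \<omega> - \<rho>) \<ge> \<delta> * sqrt \<nu>}"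
proof -
  interpret prob_space M by fact
  have "R a i \<in> measurable M (count_space (outcomes n))" if "a \<in> settings n" "i \<in> {1..m}" for a i
    using assms(5) that unfolding indep_vars_def by (auto dest!: bspec[of _ _ "(a, i)"])
  note ev = sets_rho_hat[where M = M and R = R and n = n and m = m, OF this]
  have \<rho>: "\<rho> \<in> carrier_mat (2 ^ n) (2 ^ n)" "psd_mat \<rho>"
    using assms(4) by (auto simp: density_matrix_def)
  let ?close = "{\<omega> \<in> space M. op_norm (rho_hat n m R \<omega> - \<rho>) < \<delta> * sqrt \<nu>}"
  let ?far = "{\<omega> \<in> space M. op_norm (rho_hat n m R \<omega> - \<rho>) \<ge> \<delta> * sqrt \<nu>}"
  have "1 - prob ?far = prob (space M - ?far)"
    by (rule prob_compl[symmetric]) (rule ev)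
  also have "space M - ?far = ?close" by auto
  also have "prob ?close \<le> prob {\<omega> \<in> space M. selected_rank \<nu> (rho_hat n m R \<omega>) = k}"
  proof (rule finite_measure_mono[OF _ ev])
    have "rho_hat n m R \<omega> \<in> carrier_mat (2 ^ n) (2 ^ n)" for \<omega> by (simp add: rho_hat_def)
    then show "?close \<subseteq> {\<omega> \<in> space M. selected_rank \<nu> (rho_hat n m R \<omega>) = k}"
      using assms(8,11,12) by (auto intro!: selected_rank_of_close_matrix[OF _ \<rho>])
  qed
  finally show ?thesis .
qed

end
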